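(* Let $\ell$ be a one-dimensional Lévy process with characteristic function $\phi_\ell$ and let $\Delta_n>0$ be a fixed time step. Let $F_{\Delta_n}$, the CDF of the distribution with characteristic function $(\phi_\ell)^{\Delta_n}$, be continuously differentiable on $\mathbb{R}$ with density $f_{\Delta_n}$. Assume that this distribution has finite variance and that there are constants $R>0$, $\eta>1$, $B>0$, $\theta>0$ such that $F_{\Delta_n}(-x)\le R|x|^{-\eta}$ and $1-F_{\Delta_n}(x)\le R|x|^{-\eta}$ for all $x>0$, and $|(\phi_\ell(u))^{\Delta_n}|\le B|u/(2\pi)|^{-\theta}$ for all $u\in\mathbb{R}$. Furthermore, assume that the approximation parameters $D$ and $\varepsilon$ fulfill $D=C\varepsilon^{-d}$ for $C,d>0$. Then for all $p\in[1,\eta)$ with $d<\frac1p$, $$\mathbb{E}\big(|\widetilde X-X|^p\big)\to0\quad\text{as }\varepsilon\to0 .$$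
   Context: $\mathbb{E}[\exp(iu\ell(t))]=(\phi_\ell(u))^t$. Approximated CDF: for an even integer $M$ and $\kappa,J>0$, $\widetilde F_{\Delta_n}(x):=\sum_{k=-M/2}^{M/2}q_k\exp(i2\pi kx/J)$, where $q_0=1/2$, $q_k=\frac{1-\cos(2\pi\kappa k)}{i2\pi k}(\phi_\ell(-2\pi k/J))^{\Delta_n}$ for $0<|k|<M/2$, and $q_k=0$ for $|k|=M/2$; it is real-valued. For $D,\varepsilon>0$ the parameters $0<\kappa<2/3$, $J\ge D/\kappa$ and $M$ are chosen such that $|F_{\Delta_n}(x)-\widetilde F_{\Delta_n}(x)|<\varepsilon$ for all $x\in[-D/2,D/2]$ (under the stated bounds such a choice is always possible, by a known theorem of Hughett). $X$ is a random variable on $(\Omega,(\mathcal{A}_t,t\ge0),\mathbb{P})$ with CDF $F_{\Delta_n}$ (an increment of $\ell$ over a time step $\Delta_n$), $U:=F_{\Delta_n}(X)\sim\mathcal{U}([0,1])$, and $\widetilde X:=\widetilde F_{\Delta_n}^{-1}(U)$, where $\widetilde F_{\Delta_n}^{-1}(u):=-D/2$ if $u<\min\widetilde F_{\Delta_n}([-D/2,D/2])$; $\widetilde F_{\Delta_n}^{-1}(u):=D/2$ if $u>\max\widetilde F_{\Delta_n}([-D/2,D/2])$; and $\widetilde F_{\Delta_n}^{-1}(u):=\inf\{x\in[-D/2,D/2]:\widetilde F_{\Delta_n}(x)=u\}$ otherwise. *)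

theory Defs
  imports "HOL-Probability.Probability"
begin

section \<open>Levy processes\<close>

text \<open>One-dimensional Levy process on a filtered probability space with time set \<open>[0,\<infinity>)\<close>.
  The filtration is indexed by all reals, but only its values at nonnegative times matter.
  Independence is that of finite families of increments; neither the usual conditions on the
  filtration nor cadlag paths are required.\<close>

locale levy_process = prob_space P for P :: "'a measure" +
  fixes A :: "real \<Rightarrow> 'a measure" and L :: "real \<Rightarrow> 'a \<Rightarrow> real"
  assumes filtration_subalgebra: "\<And>t. 0 \<le> t \<Longrightarrow> subalgebra P (A t)"
    and filtration_mono: "\<And>s t. 0 \<le> s \<Longrightarrow> s \<le> t \<Longrightarrow> subalgebra (A t) (A s)"
    and adapted: "\<And>t. 0 \<le> t \<Longrightarrow> L t \<in> borel_measurable (A t)"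
    and starts_at_zero: "AE \<omega> in P. L 0 \<omega> = 0"
    and independent_increments:
      "\<And>(t :: nat \<Rightarrow> real) n. 0 \<le> t 0 \<Longrightarrow> (\<And>i. i < n \<Longrightarrow> t i \<le> t (Suc i)) \<Longrightarrow>
        indep_vars (\<lambda>_. borel) (\<lambda>i \<omega>. L (t (Suc i)) \<omega> - L (t i) \<omega>) {..<n}"
    and stationary_increments:
      "\<And>s h. 0 \<le> s \<Longrightarrow> 0 \<le> h \<Longrightarrow>
        distr P borel (\<lambda>\<omega>. L (s + h) \<omega> - L s \<omega>) = distr P borel (\<lambda>\<omega>. L h \<omega> - L 0 \<omega>)"
    and stochastically_continuous:
      "\<And>t e. 0 \<le> t \<Longrightarrow> 0 < e \<Longrightarrow>
        ((\<lambda>s. prob {\<omega> \<in> space P. \<bar>L s \<omega> - L t \<omega>\<bar> > e}) \<longlongrightarrow> 0) (at t within {0..})"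

section \<open>Real powers of a characteristic function\<close>

text \<open>The power \<open>\<phi>\<^sup>t\<close> is formed with the distinguished logarithm of \<open>\<phi>\<close>, not with the principal
  branch, which would in general destroy continuity in \<open>u\<close> and the identity
  \<open>E (exp (i u L(t))) = \<phi>(u)\<^sup>t\<close>.\<close>

definition is_dist_log :: "(real \<Rightarrow> complex) \<Rightarrow> (real \<Rightarrow> complex) \<Rightarrow> bool" where
  "is_dist_log \<phi> \<psi> \<longleftrightarrow> continuous_on UNIV \<psi> \<and> \<psi> 0 = 0 \<and> (\<forall>u. exp (\<psi> u) = \<phi> u)"

definition cf_pow :: "(real \<Rightarrow> complex) \<Rightarrow> real \<Rightarrow> real \<Rightarrow> complex" where
  "cf_pow \<phi> t u = exp (of_real t * (THE \<psi>. is_dist_log \<phi> \<psi>) u)"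

lemma is_dist_log_unique:
  assumes "is_dist_log \<phi> \<psi>" "is_dist_log \<phi> \<psi>'"
  shows "\<psi> = \<psi>'"
proof -
  define h where "h u = \<psi> u - \<psi>' u" for u
  have ch: "continuous_on UNIV h"
    using assms unfolding h_def is_dist_log_def by (auto intro!: continuous_intros)
  have e1: "exp (h u) = 1" for u
  proof -
    have "exp (\<psi> u) = exp (\<psi>' u)" using assms by (simp add: is_dist_log_def)
    then show ?thesis by (simp add: h_def exp_diff)
  qed
  have "h constant_on UNIV"
  proof (rule continuous_discrete_range_constant[OF connected_UNIV ch])
    fix x :: real
    have "2 * pi \<le> norm (h y - h x)" if "h y \<noteq> h x" for y
    proof (rule ccontr)
      assume less: "\<not> 2 * pi \<le> norm (h y - h x)"
      have eq: "exp (h y) = exp (h x)" by (simp add: e1)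
      have "\<bar>Im (h y) - Im (h x)\<bar> < 2 * pi"
        using less abs_Im_le_cmod[of "h y - h x"] by simp
      from exp_complex_eqI[OF this eq] show False using that by simp
    qed
    then show "\<exists>e>0. \<forall>y. y \<in> UNIV \<and> h y \<noteq> h x \<longrightarrow> e \<le> norm (h y - h x)"
      by (intro exI[of _ "2 * pi"]) auto
  qed
  then obtain c where c: "\<And>u. h u = c" by (auto simp: constant_on_def)
  have "h 0 = 0" using assms by (simp add: h_def is_dist_log_def)
  then have "c = 0" by (simp only: c)
  show ?thesis
  proof
    fix u
    have "\<psi> u - \<psi>' u = 0" using c[of u] \<open>c = 0\<close> unfolding h_def by simp
    then show "\<psi> u = \<psi>' u" by simp
  qed
qed

lemma is_dist_log_exists:
  assumes "continuous_on UNIV \<phi>" "\<phi> 0 = 1" "\<And>u. \<phi> u \<noteq> 0"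
  shows "\<exists>\<psi>. is_dist_log \<phi> \<psi>"
proof -
  obtain g where g: "continuous_on UNIV g" "\<And>u. \<phi> u = exp (g u)"
    using continuous_logarithm_on_contractible[OF assms(1) contractible_UNIV assms(3)] by auto
  have "exp (g 0) = 1" using g(2)[of 0] assms(2) by simp
  then have "is_dist_log \<phi> (\<lambda>u. g u - g 0)"
    using g by (auto simp: is_dist_log_def exp_diff intro!: continuous_intros)
  then show ?thesis by (rule exI[where P = "is_dist_log \<phi>"])
qed

lemma cf_pow_eq:
  assumes "is_dist_log \<phi> \<psi>"
  shows "cf_pow \<phi> t u = exp (of_real t * \<psi> u)"
proof -
  have "\<psi>' = \<psi>" if "is_dist_log \<phi> \<psi>'" for \<psi>'
    using that assms by (rule is_dist_log_unique)
  then have "The (is_dist_log \<phi>) = \<psi>"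
    using the_equality[of "is_dist_log \<phi>" \<psi>] assms by metis
  then show ?thesis unfolding cf_pow_def by metis
qed

text \<open>For a Levy process the second conjunct is a consequence of the first; it is recorded here
  because it is the relation through which \<open>\<phi>\<close> describes the whole process.\<close>

definition levy_cf :: "'a measure \<Rightarrow> (real \<Rightarrow> 'a \<Rightarrow> real) \<Rightarrow> (real \<Rightarrow> complex) \<Rightarrow> bool" where
  "levy_cf P L \<phi> \<longleftrightarrow>
     (\<forall>u. \<phi> u = (CLINT \<omega>|P. iexp (u * L 1 \<omega>))) \<and>
     (\<forall>t\<ge>0. \<forall>u. (CLINT \<omega>|P. iexp (u * L t \<omega>)) = cf_pow \<phi> t u)"

section \<open>The approximated CDF and its generalized inverse\<close>

definition fourier_coeff ::
    "(real \<Rightarrow> complex) \<Rightarrow> real \<Rightarrow> real \<Rightarrow> real \<Rightarrow> nat \<Rightarrow> int \<Rightarrow> complex" where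
  "fourier_coeff \<phi> \<Delta> \<kappa> J M k =
     (if k = 0 then 1 / 2
      else if real_of_int \<bar>k\<bar> < real M / 2 then
        of_real (1 - cos (2 * pi * \<kappa> * of_int k)) / (\<i> * of_real (2 * pi * of_int k))
          * cf_pow \<phi> \<Delta> (- 2 * pi * of_int k / J)
      else 0)"

definition approx_cdf_complex ::
    "(real \<Rightarrow> complex) \<Rightarrow> real \<Rightarrow> real \<Rightarrow> real \<Rightarrow> nat \<Rightarrow> real \<Rightarrow> complex" where
  "approx_cdf_complex \<phi> \<Delta> \<kappa> J M x =
     (\<Sum>k = - int (M div 2)..int (M div 2).
        fourier_coeff \<phi> \<Delta> \<kappa> J M k * exp (\<i> * of_real (2 * pi * of_int k * x / J)))"

text \<open>The sum is real (next lemma), so taking the real part only changes its type.\<close>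

definition approx_cdf ::
    "(real \<Rightarrow> complex) \<Rightarrow> real \<Rightarrow> real \<Rightarrow> real \<Rightarrow> nat \<Rightarrow> real \<Rightarrow> real" where
  "approx_cdf \<phi> \<Delta> \<kappa> J M x = Re (approx_cdf_complex \<phi> \<Delta> \<kappa> J M x)"

lemma approx_cdf_complex_real:
  assumes "\<And>u. cf_pow \<phi> \<Delta> (- u) = cnj (cf_pow \<phi> \<Delta> u)"
  shows "approx_cdf_complex \<phi> \<Delta> \<kappa> J M x = of_real (approx_cdf \<phi> \<Delta> \<kappa> J M x)"
proof -
  let ?t = "\<lambda>k. fourier_coeff \<phi> \<Delta> \<kappa> J M k * exp (\<i> * of_real (2 * pi * of_int k * x / J))"
  have q: "fourier_coeff \<phi> \<Delta> \<kappa> J M (- k) = cnj (fourier_coeff \<phi> \<Delta> \<kappa> J M k)" for k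
    using assms[of "- 2 * pi * of_int k / J"] by (simp add: fourier_coeff_def)
  have t: "?t (- k) = cnj (?t k)" for k
    by (simp add: q exp_cnj)
  have "cnj (approx_cdf_complex \<phi> \<Delta> \<kappa> J M x) = (\<Sum>k = - int (M div 2)..int (M div 2). ?t (- k))"
    unfolding approx_cdf_complex_def cnj_sum by (rule sum.cong[OF refl]) (rule t[symmetric])
  also have "\<dots> = approx_cdf_complex \<phi> \<Delta> \<kappa> J M x"
    unfolding approx_cdf_complex_def
    by (rule sum.reindex_bij_witness[of _ uminus uminus]) auto
  finally have "approx_cdf_complex \<phi> \<Delta> \<kappa> J M x \<in> \<real>" by (simp add: Reals_cnj_iff)
  then show ?thesis by (simp add: approx_cdf_def)
qed

text \<open>For the continuous \<open>G\<close> to which it is applied, the infimum and supremum of the image of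
  the compact interval are attained, i.e. they are its minimum and maximum.\<close>

definition gen_inverse :: "(real \<Rightarrow> real) \<Rightarrow> real \<Rightarrow> real \<Rightarrow> real" where
  "gen_inverse G D u =
     (if u < Inf (G ` {- D / 2..D / 2}) then - D / 2
      else if u > Sup (G ` {- D / 2..D / 2}) then D / 2
      else Inf {x \<in> {- D / 2..D / 2}. G x = u})"

end

theory Submission
  imports Defs "HOL-Real_Asymp.Real_Asymp"
begin

text \<open>Write \<open>U = F(X)\<close>, which is uniform on \<open>[0,1]\<close>. For \<open>X\<close> in \<open>[-D/2, D/2]\<close> the generalized inverse
  satisfies \<open>|F(Xt) - F(X)| < \<epsilon>\<close>. As \<open>U\<close> almost surely avoids the countable set \<open>F(\<rat>)\<close>, the CDF is
  strictly increasing at \<open>X\<close>, and therefore \<open>Xt\<close> tends to \<open>X\<close> almost surely. If \<open>Xt > 0\<close>, then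
  \<open>1 - U < \<epsilon> + R Xt\<^sup>-\<^sup>\<eta>\<close>: either \<open>Xt\<^sup>p \<le> (2R/(1-U))\<^sup>p\<^sup>/\<^sup>\<eta>\<close>, which is integrable because
  \<open>p < \<eta>\<close>, or \<open>1 - U < 2\<epsilon>\<close>, an event that contributes at most \<open>2\<epsilon>D\<^sup>p = O(\<epsilon>\<^sup>1\<^sup>-\<^sup>d\<^sup>p)\<close>. The case
  \<open>Xt < 0\<close> is symmetric, and dominated convergence handles the integrable part.\<close>

section \<open>The generalized inverse of a continuous function on the window\<close>

text \<open>The continuous image of the nonempty compact window is a compact interval
  \<open>{c..d}\<close>, so a value that is not clipped is attained. Its level set is closed and
  bounded, hence contains its infimum.\<close>

lemma gen_inverse_cases:
  assumes G: "continuous_on {- D / 2..D / 2} G" and D: "0 \<le> D"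
  obtains (below) "u < Inf (G ` {- D / 2..D / 2})" "gen_inverse G D u = - D / 2"
    | (above) "u > Sup (G ` {- D / 2..D / 2})" "gen_inverse G D u = D / 2"
    | (attained) "gen_inverse G D u \<in> {- D / 2..D / 2}" "G (gen_inverse G D u) = u"
proof -
  let ?I = "{- D / 2..D / 2}"
  have "- D / 2 \<le> D / 2" using D by simp
  with G obtain c d where cd: "G ` ?I = {c..d}" "c \<le> d"
    using continuous_image_closed_interval[of "- D / 2" "D / 2" G] by blast
  show thesis
  proof (cases "u \<in> {c..d}")
    case True
    let ?S = "{x \<in> ?I. G x = u}"
    from True have "u \<in> G ` ?I" by (simp only: cd(1))
    then have "?S \<noteq> {}" by blast
    moreover have "closed ?S"
      using continuous_closed_preimage[OF G closed_atLeastAtMost closed_singleton[of u]]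
      by (simp add: vimage_def Int_def)
    moreover have "bdd_below ?S" by (rule bdd_belowI[of _ "- D / 2"]) auto
    ultimately have "Inf ?S \<in> ?S" by (intro closed_contains_Inf)
    moreover have "gen_inverse G D u = Inf ?S"
      using True cd by (simp add: gen_inverse_def)
    ultimately show thesis using attained by simp
  next
    case False
    then show thesis using below above cd D by (auto simp: gen_inverse_def not_le)
  qed
qed

lemma gen_inverse_mem:
  assumes "continuous_on {- D / 2..D / 2} G" "0 \<le> D"
  shows "gen_inverse G D u \<in> {- D / 2..D / 2}"
  using gen_inverse_cases[OF assms, of u] by (cases) (use assms(2) in auto)

text \<open>An attained value gives \<open>G y = F x\<close>, and the error bound at
  \<open>y\<close> suffices. A clipped one uses the monotonicity of \<open>F\<close>: on the left,
  F(-D/2) \<le> F(x) < min G \<le> G(-D/2) < F(-D/2) + \<epsilon>, and symmetrically on the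
  right.\<close>

lemma gen_inverse_cdf_close:
  fixes F :: "real \<Rightarrow> real"
  assumes G: "continuous_on {- D / 2..D / 2} G" and D: "0 \<le> D"
    and F: "mono F" and close: "\<And>x. x \<in> {- D / 2..D / 2} \<Longrightarrow> \<bar>F x - G x\<bar> < \<epsilon>"
    and x: "x \<in> {- D / 2..D / 2}"
  shows "\<bar>F (gen_inverse G D (F x)) - F x\<bar> < \<epsilon>"
proof -
  let ?I = "{- D / 2..D / 2}"
  have bdd: "bdd_below (G ` ?I)" "bdd_above (G ` ?I)"
    using compact_continuous_image[OF G compact_Icc]
    by (auto intro: bounded_imp_bdd_below bounded_imp_bdd_above compact_imp_bounded)
  have ends: "- D / 2 \<in> ?I" "D / 2 \<in> ?I" using D by auto
  consider (below) "F x < Inf (G ` ?I)" "gen_inverse G D (F x) = - D / 2"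
    | (above) "F x > Sup (G ` ?I)" "gen_inverse G D (F x) = D / 2"
    | (attained) "gen_inverse G D (F x) \<in> ?I" "G (gen_inverse G D (F x)) = F x"
    using gen_inverse_cases[OF G D, of "F x"] by blast
  then show ?thesis
  proof cases
    case below
    moreover have "Inf (G ` ?I) \<le> G (- D / 2)" by (intro cInf_lower bdd imageI ends)
    moreover have "F (- D / 2) \<le> F x" using x by (intro monoD[OF F]) auto
    ultimately show ?thesis using close[OF ends(1)] unfolding below(2) by linarith
  next
    case above
    moreover have "G (D / 2) \<le> Sup (G ` ?I)" by (intro cSup_upper bdd imageI ends)
    moreover have "F x \<le> F (D / 2)" using x by (intro monoD[OF F]) auto
    ultimately show ?thesis using close[OF ends(2)] unfolding above(2) by linarith
  next
    case attained
    then show ?thesis using close[OF attained(1)] by simp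
  qed
qed

text \<open>\<open>G\<close> need not be monotone, and neither need its generalized inverse be, so
  measurability is read off the sublevel sets. For a level \<open>a\<close> inside the window, the
  smallest solution is at most \<open>a\<close> iff some solution is; the sublevel set is thus a
  half-line of clipped values together with the compact image of
  \<open>{- D / 2..a}\<close>.\<close>

lemma borel_measurable_gen_inverse:
  assumes G: "continuous_on {- D / 2..D / 2} G" and D: "0 \<le> D"
  shows "gen_inverse G D \<in> borel_measurable borel"
proof (rule borel_measurableI_le)
  fix a
  let ?I = "{- D / 2..D / 2}"
  let ?m = "Inf (G ` ?I)"
  have bdd: "bdd_below (G ` ?I)" "bdd_above (G ` ?I)"
    using compact_continuous_image[OF G compact_Icc]
    by (auto intro: bounded_imp_bdd_below bounded_imp_bdd_above compact_imp_bounded)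
  consider "a < - D / 2" | "D / 2 \<le> a" | "- D / 2 \<le> a" "a < D / 2" by linarith
  then show "{u \<in> space borel. gen_inverse G D u \<le> a} \<in> sets borel"
  proof cases
    case 1
    have "\<not> gen_inverse G D u \<le> a" for u
      using gen_inverse_mem[OF G D, of u] 1 by auto
    then show ?thesis by simp
  next
    case 2
    have "gen_inverse G D u \<le> a" for u
      using gen_inverse_mem[OF G D, of u] 2 by auto
    then show ?thesis by simp
  next
    case 3
    have "gen_inverse G D u \<le> a \<longleftrightarrow> u < ?m \<or> u \<in> G ` {- D / 2..a}" for u
    proof
      assume "gen_inverse G D u \<le> a"
      with 3 show "u < ?m \<or> u \<in> G ` {- D / 2..a}"
        by (cases rule: gen_inverse_cases[OF G D, of u]) (auto intro!: image_eqI)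
    next
      assume R: "u < ?m \<or> u \<in> G ` {- D / 2..a}"
      show "gen_inverse G D u \<le> a"
      proof (cases "u < ?m")
        case True
        then show ?thesis using 3 by (simp add: gen_inverse_def)
      next
        case False
        with R obtain y where y: "y \<in> {- D / 2..a}" "G y = u" by auto
        then have "G y \<le> Sup (G ` ?I)" using 3 by (intro cSup_upper bdd imageI) auto
        with False y have "gen_inverse G D u = Inf {x \<in> ?I. G x = u}"
          by (simp add: gen_inverse_def)
        also have "\<dots> \<le> y" using y 3 by (intro cInf_lower bdd_belowI[of _ "- D / 2"]) auto
        finally show ?thesis using y by simp
      qed
    qed
    then have "{u \<in> space borel. gen_inverse G D u \<le> a} = {..<?m} \<union> G ` {- D / 2..a}"
      by auto
    moreover have "G ` {- D / 2..a} \<in> sets borel"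
      using 3 by (intro borel_closed compact_imp_closed compact_continuous_image continuous_on_subset[OF G]) auto
    ultimately show ?thesis by (simp only: sets.Un lessThan_borel)
  qed
qed

section \<open>The probability integral transform and uniform variables\<close>

text \<open>Continuity makes every level in (0,1) a value of \<open>F\<close>, but \<open>F\<close>
  may have flat pieces and no inverse. The distribution function of F(X) is therefore squeezed
  between two bounds that use only monotonicity.\<close>

lemma (in prob_space) cdf_transform_uniform:
  fixes X :: "'a \<Rightarrow> real"
  assumes X [measurable]: "X \<in> borel_measurable M"
    and F: "F = cdf (distr M borel X)" and cont: "continuous_on UNIV F"
  shows "distributed M lborel (\<lambda>\<omega>. F (X \<omega>)) (\<lambda>x. indicator {0..1} x / measure lborel {0..1 :: real})"
proof (rule uniform_distrI_borel_atLeastAtMost)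
  interpret D: real_distribution "distr M borel X"
    by (intro real_distribution_distr X)
  have mono: "mono F" unfolding F by (auto intro: monoI D.cdf_nondecreasing)
  have F_prob: "F x = prob {\<omega> \<in> space M. X \<omega> \<le> x}" for x
    unfolding F cdf_def by (subst measure_distr) (auto intro!: arg_cong[where f = prob])
  have top: "(F \<longlongrightarrow> 1) at_top" and bot: "(F \<longlongrightarrow> 0) at_bot"
    using D.cdf_lim_at_top_prob D.cdf_lim_at_bot by (simp_all add: F)
  have [measurable]: "F \<in> borel_measurable borel"
    by (rule borel_measurable_continuous_onI[OF cont])
  show "(\<lambda>\<omega>. F (X \<omega>)) \<in> borel_measurable M" by measurable
  \<comment> \<open>The level \<open>s\<close> lies strictly above \<open>t\<close>: with F(c) = t
    the point X could exceed \<open>c\<close> on a flat piece while still F(X) = t.\<close>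
  have le: "prob {\<omega> \<in> space M. F (X \<omega>) \<le> t} \<le> s" if "t < s" "0 < s" "s < 1" for t s
  proof -
    obtain a where a: "F a < s" using order_tendstoD(2)[OF bot \<open>0 < s\<close>]
      by (auto simp: eventually_at_bot_linorder)
    obtain b where b: "s < F b" using order_tendstoD(1)[OF top \<open>s < 1\<close>]
      by (auto simp: eventually_at_top_linorder)
    have "a \<le> b" using a b monoD[OF mono, of b a] by linarith
    then obtain c where c: "F c = s"
      using IVT'[of F a s b] a b continuous_on_subset[OF cont] by auto
    have "X \<omega> \<le> c" if "F (X \<omega>) \<le> t" for \<omega>
      using that \<open>t < s\<close> c monoD[OF mono, of c "X \<omega>"] by linarith
    then have "prob {\<omega> \<in> space M. F (X \<omega>) \<le> t} \<le> prob {\<omega> \<in> space M. X \<omega> \<le> c}"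
      by (intro finite_measure_mono) auto
    then show ?thesis using c F_prob by simp
  qed
  have ge: "t \<le> prob {\<omega> \<in> space M. F (X \<omega>) \<le> t}" if "0 < t" "t < 1" for t
  proof -
    obtain a where a: "F a < t" using order_tendstoD(2)[OF bot \<open>0 < t\<close>]
      by (auto simp: eventually_at_bot_linorder)
    obtain b where b: "t < F b" using order_tendstoD(1)[OF top \<open>t < 1\<close>]
      by (auto simp: eventually_at_top_linorder)
    have "a \<le> b" using a b monoD[OF mono, of b a] by linarith
    then obtain c where c: "F c = t"
      using IVT'[of F a t b] a b continuous_on_subset[OF cont] by auto
    then have "prob {\<omega> \<in> space M. X \<omega> \<le> c} \<le> prob {\<omega> \<in> space M. F (X \<omega>) \<le> t}"
      by (intro finite_measure_mono) (auto intro: monoD[OF mono])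
    then show ?thesis using c F_prob by simp
  qed
  fix t :: real assume t: "0 \<le> t" "t \<le> 1"
  have "prob {\<omega> \<in> space M. F (X \<omega>) \<le> t} = t"
  proof (cases "t = 1")
    case True
    then have "{\<omega> \<in> space M. F (X \<omega>) \<le> t} = space M"
      using D.cdf_bounded_prob by (auto simp: F)
    then show ?thesis using True prob_space by simp
  next
    case False
    have "prob {\<omega> \<in> space M. F (X \<omega>) \<le> t} \<le> t"
    \<comment> \<open>Letting \<open>s\<close> decrease to \<open>t\<close> removes the slack; this
      needs room below 1, which is why \<open>t = 1\<close> is treated apart.\<close>
    proof (rule dense_ge_bounded[of t 1])
      show "t < 1" using False t by simp
      show "prob {\<omega> \<in> space M. F (X \<omega>) \<le> t} \<le> s" if "t < s" "s < 1" for s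
        using le[of t s] that t by simp
    qed
    moreover have "t \<le> prob {\<omega> \<in> space M. F (X \<omega>) \<le> t}"
      using ge[of t] t False by (cases "t = 0") auto
    ultimately show ?thesis by simp
  qed
  then show "prob {\<omega> \<in> space M. F (X \<omega>) \<le> t} = (t - 0) / (1 - 0)" by simp
qed simp

text \<open>Negative powers above -1 are integrable at 0, and reflection at 1/2 carries this to the
  other end. It is applied with exponent -p/\<eta>, so this is where p < \<eta> matters.\<close>

lemma (in prob_space) integrable_powr_uniform:
  fixes U :: "'a \<Rightarrow> real"
  assumes U: "distributed M lborel U (\<lambda>x. indicator {0..1} x / measure lborel {0..1 :: real})"
    and a: "-1 < a"
  shows "integrable M (\<lambda>\<omega>. U \<omega> powr a)" "integrable M (\<lambda>\<omega>. (1 - U \<omega>) powr a)"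
proof -
  have "(\<lambda>t. t powr a) absolutely_integrable_on {0..1 :: real}"
    using integrable_on_powr_from_0[OF a, of 1]
    by (subst absolutely_integrable_on_iff_nonneg) auto
  then have I: "integrable lborel (\<lambda>x. indicat_real {0..1} x *\<^sub>R (x powr a))"
    unfolding set_integrable_def by (subst (asm) integrable_completion) auto
  then show "integrable M (\<lambda>\<omega>. U \<omega> powr a)"
    by (subst distributed_integrable[OF U, symmetric]) auto
  \<comment> \<open>The reflection x \<mapsto> 1 - x is written in the affine form that the
    substitution rule expects.\<close>
  have "integrable lborel (\<lambda>x. indicat_real {0..1} (1 + (-1) * x) *\<^sub>R ((1 + (-1) * x) powr a))"
    by (rule lborel_integrable_real_affine[OF I]) simp
  also have "(\<lambda>x. indicat_real {0..1} (1 + (-1) * x) *\<^sub>R ((1 + (-1) * x) powr a)) =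
      (\<lambda>x. indicat_real {0..1} x / measure lborel {0..1 :: real} * (1 - x) powr a)"
    by (auto simp: indicator_def fun_eq_iff)
  finally show "integrable M (\<lambda>\<omega>. (1 - U \<omega>) powr a)"
    by (subst distributed_integrable[OF U, symmetric]) auto
qed

lemma (in prob_space) AE_uniform_not_in_countable:
  fixes U :: "'a \<Rightarrow> real"
  assumes U: "distributed M lborel U (\<lambda>x. indicator {0..1} x / measure lborel {0..1 :: real})"
    and S: "countable S"
  shows "AE \<omega> in M. U \<omega> \<notin> S"
proof -
  have "AE x in lborel. x \<notin> S"
    using AE_not_in[OF countable_imp_null_set_lborel[OF S]] .
  then have "AE x in distr M lborel U. x \<notin> S"
    unfolding distributed_distr_eq_density[OF U]
    by (subst AE_density) (auto simp: distributed_borel_measurable[OF U])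
  then show ?thesis
    using distributed_measurable[OF U] countable_imp_null_set_lborel[OF S]
    by (subst (asm) AE_distr_iff) (auto simp: null_sets_def Collect_neg_eq[symmetric])
qed

text \<open>Removes the points where \<open>R / v\<close> would be a division by zero with default
  value 0, which would spoil the quantile bounds below.\<close>

lemma (in prob_space) AE_uniform_open_interval:
  fixes U :: "'a \<Rightarrow> real"
  assumes U: "distributed M lborel U (\<lambda>x. indicator {0..1} x / measure lborel {0..1 :: real})"
  shows "AE \<omega> in M. 0 < U \<omega> \<and> U \<omega> < 1"
proof -
  have [measurable]: "U \<in> borel_measurable M" using distributed_measurable[OF U] by simp
  have "prob {\<omega> \<in> space M. U \<omega> \<le> 1} = 1" "prob {\<omega> \<in> space M. U \<omega> \<le> 0} = 0"
    using uniform_distributed_measure[OF U, of 1] uniform_distributed_measure[OF U, of 0]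
    by simp_all
  then have "AE \<omega> in M. U \<omega> \<le> 1" "AE \<omega> in M. \<not> U \<omega> \<le> 0"
    by (auto simp: prob_Collect_eq_1 prob_Collect_eq_0)
  moreover have "AE \<omega> in M. U \<omega> \<notin> {1}"
    using AE_uniform_not_in_countable[OF U] by blast
  ultimately show ?thesis by eventually_elim auto
qed

text \<open>Applied with \<open>t = 2 * \<epsilon>\<close>, which may exceed 1; hence an inequality,
  trivial in that range.\<close>

lemma (in prob_space) prob_uniform_tails_le:
  fixes U :: "'a \<Rightarrow> real"
  assumes U: "distributed M lborel U (\<lambda>x. indicator {0..1} x / measure lborel {0..1 :: real})"
    and t: "0 \<le> t"
  shows "prob {\<omega> \<in> space M. U \<omega> < t} \<le> t" "prob {\<omega> \<in> space M. 1 - U \<omega> < t} \<le> t"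
proof -
  have [measurable]: "U \<in> borel_measurable M" using distributed_measurable[OF U] by simp
  have "prob {\<omega> \<in> space M. U \<omega> < t} \<le> t \<and> prob {\<omega> \<in> space M. 1 - U \<omega> < t} \<le> t"
  proof (cases "t \<le> 1")
    case True
    have "prob {\<omega> \<in> space M. U \<omega> < t} \<le> prob {\<omega> \<in> space M. U \<omega> \<le> t}"
      by (intro finite_measure_mono) auto
    also have "\<dots> = t" using uniform_distributed_measure[OF U, of t] t True by simp
    finally have 1: "prob {\<omega> \<in> space M. U \<omega> < t} \<le> t" .
    have "prob {\<omega> \<in> space M. 1 - U \<omega> < t} = prob {\<omega> \<in> space M. \<not> U \<omega> \<le> 1 - t}"
      by (intro arg_cong[where f = prob]) auto
    also have "\<dots> = 1 - prob {\<omega> \<in> space M. U \<omega> \<le> 1 - t}" by (rule prob_neg) simp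
    also have "\<dots> = t" using uniform_distributed_measure[OF U, of "1 - t"] t True by simp
    finally show ?thesis using 1 by simp
  next
    case False
    then show ?thesis by (meson linear order_trans prob_le_1)
  qed
  then show "prob {\<omega> \<in> space M. U \<omega> < t} \<le> t" "prob {\<omega> \<in> space M. 1 - U \<omega> < t} \<le> t" by auto
qed

section \<open>Pointwise bounds from the power tails\<close>

text \<open>Solving the tail bound for \<open>y\<close> turns it into a quantile bound: y is at most
  (R/v) to the power 1/\<eta>, where \<open>v\<close> will be the tail mass U or 1 - U.\<close>

lemma powr_le_of_powr_tail:
  fixes y v R \<eta> p :: real
  assumes "0 < y" "0 < v" "0 < \<eta>" "0 \<le> p" and tail: "v \<le> R * y powr (- \<eta>)"
  shows "y powr p \<le> (R / v) powr (p / \<eta>)"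
proof -
  have "y powr p = (y powr \<eta>) powr (p / \<eta>)" using assms by (simp add: powr_powr)
  also have "y powr \<eta> \<le> R / v"
    using tail assms by (simp add: powr_minus field_simps)
  then have "(y powr \<eta>) powr (p / \<eta>) \<le> (R / v) powr (p / \<eta>)"
    using assms by (intro powr_mono2) auto
  finally show ?thesis .
qed

text \<open>If v \<ge> 2\<epsilon>, the perturbation is at most v/2 and is absorbed by doubling
  \<open>R\<close>. Otherwise only the size of the window bounds \<open>y\<close>, and the indicator
  records this rare event.\<close>

lemma powr_le_of_perturbed_powr_tail:
  fixes y v R \<eta> p :: real
  assumes "0 < y" "0 < v" "0 < \<eta>" "0 \<le> p" "y \<le> D" and tail: "v < \<epsilon> + R * y powr (- \<eta>)"
  shows "y powr p \<le> (2 * R / v) powr (p / \<eta>) + D powr p * indicator {..<2 * \<epsilon>} v"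
proof (cases "v < 2 * \<epsilon>")
  case True
  then show ?thesis using powr_mono2[of p y D] assms by (simp add: add_increasing)
next
  case False
  then have "v \<le> 2 * R * y powr (- \<eta>)" using tail by simp
  then show ?thesis
    using powr_le_of_powr_tail[of y v \<eta> p "2 * R"] assms False by simp
qed

text \<open>Here \<open>x\<close> is a value of X and \<open>y\<close> its approximation. Both p-th
  powers are controlled by functions of the uniform value F(x), so the bound splits into an
  \<epsilon>-free part and a part living on tail masses below 2\<epsilon>.\<close>

lemma cdf_close_powr_bound:
  fixes F :: "real \<Rightarrow> real" and R \<eta> p x y :: real
  assumes par: "0 < R" "0 < \<eta>" "0 \<le> p"
    and tails: "\<And>x. x > 0 \<Longrightarrow> F (- x) \<le> R * \<bar>x\<bar> powr (- \<eta>)"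
               "\<And>x. x > 0 \<Longrightarrow> 1 - F x \<le> R * \<bar>x\<bar> powr (- \<eta>)"
    and u: "0 < F x" "F x < 1"
    and y: "y \<in> {- D / 2..D / 2}"
    and close: "x \<in> {- D / 2..D / 2} \<Longrightarrow> \<bar>F y - F x\<bar> < \<epsilon>"
  shows "\<bar>y - x\<bar> powr p \<le>
    2 powr p * (2 * ((2 * R / F x) powr (p / \<eta>) + (2 * R / (1 - F x)) powr (p / \<eta>))) +
    2 powr p * (D powr p * (indicator {..<2 * \<epsilon>} (F x) + indicator {..<2 * \<epsilon>} (1 - F x)))"
proof -
  \<comment> \<open>The factor 2 is needed for \<open>y\<close> only; the tail bounds for
    \<open>x\<close> are weakened from \<open>R\<close> to \<open>2 * R\<close> so that both share
    one \<open>h\<close>.\<close>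
  define h where "h v = (2 * R / v) powr (p / \<eta>)" for v
  define b where "b = D powr p * (indicator {..<2 * \<epsilon>} (F x) + indicator {..<2 * \<epsilon>} (1 - F x) :: real)"
  have h0: "0 \<le> h v" for v by (simp add: h_def)
  have b0: "0 \<le> b" by (simp add: b_def)
  have hb: "h v + D powr p * indicator {..<2 * \<epsilon>} v \<le> h (F x) + h (1 - F x) + b"
    if "v = F x \<or> v = 1 - F x" for v
    using that h0 by (auto simp: b_def distrib_left)
  have xb: "\<bar>x\<bar> powr p \<le> h (F x) + h (1 - F x)"
  proof -
    consider "x = 0" | "x > 0" | "x < 0" by linarith
    then show ?thesis
    proof cases
      case 1 then show ?thesis using h0 by (simp add: add_nonneg_nonneg)
    next
      case 2
      then have "1 - F x \<le> 2 * R * x powr (- \<eta>)"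
        using tails(2)[OF 2] par by (simp add: order_trans[OF _ mult_right_mono[of R "2 * R"]])
      then have "x powr p \<le> h (1 - F x)"
        unfolding h_def using 2 u par by (intro powr_le_of_powr_tail) auto
      then show ?thesis using 2 h0[of "F x"] by simp
    next
      case 3
      then have "F x \<le> 2 * R * (- x) powr (- \<eta>)"
        using tails(1)[of "- x"] par by (simp add: order_trans[OF _ mult_right_mono[of R "2 * R"]])
      then have "(- x) powr p \<le> h (F x)"
        unfolding h_def using 3 u par by (intro powr_le_of_powr_tail) auto
      then show ?thesis using 3 h0[of "1 - F x"] by simp
    qed
  qed
  have yb: "\<bar>y\<bar> powr p \<le> h (F x) + h (1 - F x) + b"
  proof (cases "x \<in> {- D / 2..D / 2}")
    case False
    \<comment> \<open>Outside the window no closeness of \<open>F\<close> is available, but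
      \<open>y\<close> lies in the window and is thus nearer to 0 than \<open>x\<close>.\<close>
    then have "\<bar>y\<bar> \<le> \<bar>x\<bar>" using y by auto
    then have "\<bar>y\<bar> powr p \<le> \<bar>x\<bar> powr p" using par by (intro powr_mono2) auto
    then show ?thesis using xb b0 by simp
  next
    case True
    note cl = close[OF True]
    consider "y = 0" | "y > 0" | "y < 0" by linarith
    then show ?thesis
    proof cases
      case 1 then show ?thesis using h0 b0 by (simp add: add_nonneg_nonneg)
    next
      case 2
      \<comment> \<open>The tail bound is used at \<open>y\<close>, and closeness moves it to the
        tail mass at \<open>x\<close> at the cost of \<epsilon>.\<close>
      then have "1 - F x < \<epsilon> + R * y powr (- \<eta>)" using tails(2)[OF 2] cl by simp
      then have "y powr p \<le> h (1 - F x) + D powr p * indicator {..<2 * \<epsilon>} (1 - F x)"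
        unfolding h_def using 2 y u par by (intro powr_le_of_perturbed_powr_tail) auto
      then show ?thesis using 2 hb[of "1 - F x"] by simp
    next
      case 3
      then have "F x < \<epsilon> + R * (- y) powr (- \<eta>)" using tails(1)[of "- y"] cl by simp
      then have "(- y) powr p \<le> h (F x) + D powr p * indicator {..<2 * \<epsilon>} (F x)"
        unfolding h_def using 3 y u par by (intro powr_le_of_perturbed_powr_tail) auto
      then show ?thesis using 3 hb[of "F x"] by simp
    qed
  qed
  have "\<bar>y - x\<bar> \<le> 2 * max \<bar>y\<bar> \<bar>x\<bar>" by linarith
  then have "\<bar>y - x\<bar> powr p \<le> (2 * max \<bar>y\<bar> \<bar>x\<bar>) powr p" using par by (intro powr_mono2) auto
  also have "\<dots> = 2 powr p * max \<bar>y\<bar> \<bar>x\<bar> powr p" by (simp add: powr_mult)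
  also have "max \<bar>y\<bar> \<bar>x\<bar> powr p \<le> \<bar>y\<bar> powr p + \<bar>x\<bar> powr p" by (auto simp: max_def)
  then have "2 powr p * max \<bar>y\<bar> \<bar>x\<bar> powr p \<le> 2 powr p * (\<bar>y\<bar> powr p + \<bar>x\<bar> powr p)" by simp
  also have "\<bar>y\<bar> powr p + \<bar>x\<bar> powr p \<le> 2 * (h (F x) + h (1 - F x)) + b" using xb yb by simp
  then have "2 powr p * (\<bar>y\<bar> powr p + \<bar>x\<bar> powr p) \<le> 2 powr p * (2 * (h (F x) + h (1 - F x)) + b)"
    by simp
  finally show ?thesis by (simp add: h_def b_def distrib_left)
qed

section \<open>Almost sure convergence\<close>

text \<open>If \<open>F\<close> were constant on an interval with endpoint X, a rational inside it
  would have the same value as X. So F(X) would lie in the countable image of the rationals, which a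
  uniform variable almost surely avoids.\<close>

lemma (in prob_space) AE_strictly_increasing_cdf:
  fixes X :: "'a \<Rightarrow> real"
  assumes X: "X \<in> borel_measurable M"
    and F: "F = cdf (distr M borel X)" and cont: "continuous_on UNIV F"
  shows "AE \<omega> in M. \<forall>y. (y < X \<omega> \<longrightarrow> F y < F (X \<omega>)) \<and> (X \<omega> < y \<longrightarrow> F (X \<omega>) < F y)"
proof -
  interpret D: real_distribution "distr M borel X"
    by (intro real_distribution_distr X)
  have mono: "F a \<le> F b" if "a \<le> b" for a b
    unfolding F using that by (rule D.cdf_nondecreasing)
  have "AE \<omega> in M. F (X \<omega>) \<notin> F ` \<rat>"
    by (intro AE_uniform_not_in_countable[OF cdf_transform_uniform[OF X F cont]]
        countable_image countable_rat)
  then show ?thesis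
  proof eventually_elim
    case (elim \<omega>)
    have "F a < F b" if "a < b" "a = X \<omega> \<or> b = X \<omega>" for a b
    proof (rule ccontr)
      assume "\<not> F a < F b"
      obtain r where r: "r \<in> \<rat>" "a < r" "r < b" using Rats_dense_in_real[OF \<open>a < b\<close>] by auto
      then have "F r = F (X \<omega>)"
        using mono[of a r] mono[of r b] \<open>\<not> F a < F b\<close> that by auto
      then show False using elim r by (metis imageI)
    qed
    then show ?case by blast
  qed
qed

text \<open>For a < x, a point at or below \<open>a\<close> has \<open>F\<close>-value at most F(a)
  < F(x), which the limit eventually excludes; likewise from above.\<close>

lemma tendsto_of_cdf_close:
  fixes F :: "real \<Rightarrow> real"
  assumes F: "mono F"
    and strict: "\<And>y. y < x \<Longrightarrow> F y < F x" "\<And>y. x < y \<Longrightarrow> F x < F y"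
    and lim: "((\<lambda>\<epsilon>. F (y \<epsilon>)) \<longlongrightarrow> F x) A"
  shows "(y \<longlongrightarrow> x) A"
proof (rule order_tendstoI)
  fix a assume "a < x"
  from order_tendstoD(1)[OF lim strict(1)[OF this]]
  show "eventually (\<lambda>\<epsilon>. a < y \<epsilon>) A" by eventually_elim (meson F monoD not_le)
next
  fix a assume "x < a"
  from order_tendstoD(2)[OF lim strict(2)[OF this]]
  show "eventually (\<lambda>\<epsilon>. y \<epsilon> < a) A" by eventually_elim (meson F monoD not_le)
qed

section \<open>Dominated convergence up to a term vanishing in mean\<close>

text \<open>The majorant \<open>g + b \<epsilon>\<close> varies with \<epsilon>, so dominated
  convergence is applied to min(W, g) with the fixed majorant \<open>g\<close>. What is cut off is
  at most \<open>b \<epsilon>\<close>, whose integral tends to 0.\<close>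

lemma integral_tendsto_0_dominated_up_to:
  fixes W b :: "real \<Rightarrow> 'a \<Rightarrow> real"
  assumes W: "\<And>\<epsilon>. \<epsilon> \<in> S - {a} \<Longrightarrow> integrable M (W \<epsilon>)" "\<And>\<epsilon> \<omega>. 0 \<le> W \<epsilon> \<omega>"
    and g: "integrable M g" "\<And>\<omega>. 0 \<le> g \<omega>"
    and b: "\<And>\<epsilon>. \<epsilon> \<in> S - {a} \<Longrightarrow> integrable M (b \<epsilon>)" "\<And>\<epsilon> \<omega>. 0 \<le> b \<epsilon> \<omega>"
      "((\<lambda>\<epsilon>. \<integral>\<omega>. b \<epsilon> \<omega> \<partial>M) \<longlongrightarrow> 0) (at a within S)"
    and le: "\<And>\<epsilon>. \<epsilon> \<in> S - {a} \<Longrightarrow> AE \<omega> in M. W \<epsilon> \<omega> \<le> g \<omega> + b \<epsilon> \<omega>"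
    and lim: "AE \<omega> in M. ((\<lambda>\<epsilon>. W \<epsilon> \<omega>) \<longlongrightarrow> 0) (at a within S)"
  shows "((\<lambda>\<epsilon>. \<integral>\<omega>. W \<epsilon> \<omega> \<partial>M) \<longlongrightarrow> 0) (at a within S)"
  unfolding tendsto_at_iff_sequentially
proof (intro allI impI)
  fix e :: "nat \<Rightarrow> real" assume e: "\<forall>i. e i \<in> S - {a}" "e \<longlonglongrightarrow> a"
  have min_int: "integrable M (\<lambda>\<omega>. min (W (e i) \<omega>) (g \<omega>))" for i
    using W(1) g(1) e by (intro integrable_min) auto
  have "(\<lambda>i. \<integral>\<omega>. min (W (e i) \<omega>) (g \<omega>) \<partial>M) \<longlonglongrightarrow> (\<integral>\<omega>. 0 \<partial>M)"
  proof (rule integral_dominated_convergence[where w = g])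
    show "AE \<omega> in M. (\<lambda>i. min (W (e i) \<omega>) (g \<omega>)) \<longlonglongrightarrow> 0"
      using lim
    proof eventually_elim
      case (elim \<omega>)
      then have "(\<lambda>i. W (e i) \<omega>) \<longlonglongrightarrow> 0"
        using e unfolding tendsto_at_iff_sequentially by (auto simp: o_def)
      then show ?case
        by (rule tendsto_sandwich[rotated 2, OF tendsto_const]) (auto simp: W(2) g(2))
    qed
  qed (use g W(2) min_int borel_measurable_integrable in \<open>auto simp: min_def\<close>)
  moreover have "(\<lambda>i. \<integral>\<omega>. b (e i) \<omega> \<partial>M) \<longlonglongrightarrow> 0"
    using b(3) e unfolding tendsto_at_iff_sequentially by (auto simp: o_def)
  ultimately have lim0:
    "(\<lambda>i. (\<integral>\<omega>. min (W (e i) \<omega>) (g \<omega>) \<partial>M) + (\<integral>\<omega>. b (e i) \<omega> \<partial>M)) \<longlonglongrightarrow> 0"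
    using tendsto_add by fastforce
  have "(\<integral>\<omega>. W (e i) \<omega> \<partial>M) \<le> (\<integral>\<omega>. min (W (e i) \<omega>) (g \<omega>) \<partial>M) + (\<integral>\<omega>. b (e i) \<omega> \<partial>M)" for i
  proof -
    have ei: "e i \<in> S - {a}" using e by simp
    have "(\<integral>\<omega>. W (e i) \<omega> \<partial>M) \<le> (\<integral>\<omega>. min (W (e i) \<omega>) (g \<omega>) + b (e i) \<omega> \<partial>M)"
    proof (rule integral_mono_AE)
      show "AE \<omega> in M. W (e i) \<omega> \<le> min (W (e i) \<omega>) (g \<omega>) + b (e i) \<omega>"
        using le[OF ei] by eventually_elim (use b(2)[of "e i"] in \<open>auto simp: min_def\<close>)
    qed (use W(1)[OF ei] min_int b(1)[OF ei] in auto)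
    then show ?thesis by (simp add: min_int b(1)[OF ei])
  qed
  then show "((\<lambda>\<epsilon>. \<integral>\<omega>. W \<epsilon> \<omega> \<partial>M) \<circ> e) \<longlonglongrightarrow> 0"
    unfolding o_def using W(2)
    by (intro tendsto_sandwich[OF _ _ tendsto_const lim0]) (auto intro!: always_eventually integral_nonneg_AE)
qed

section \<open>Convergence in p-th mean\<close>

text \<open>The approximation is kept abstract: \<open>G \<epsilon>\<close> is any function
  continuous on the window and within \<epsilon> of \<open>F\<close> there.\<close>

theorem (in prob_space) gen_inverse_Lp_convergence:
  fixes X :: "'a \<Rightarrow> real" and F :: "real \<Rightarrow> real" and G :: "real \<Rightarrow> real \<Rightarrow> real" and D :: "real \<Rightarrow> real"
    and R \<eta> C d p :: real
  assumes X [measurable]: "X \<in> borel_measurable M"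
    and F: "F = cdf (distr M borel X)" and cont: "continuous_on UNIV F"
    and par: "0 < R" "0 < p" "p < \<eta>"
    and tails: "\<And>x. x > 0 \<Longrightarrow> F (- x) \<le> R * \<bar>x\<bar> powr (- \<eta>)"
               "\<And>x. x > 0 \<Longrightarrow> 1 - F x \<le> R * \<bar>x\<bar> powr (- \<eta>)"
    and D: "0 < C" "0 < d" "d < 1 / p" "\<And>\<epsilon>. \<epsilon> > 0 \<Longrightarrow> D \<epsilon> = C * \<epsilon> powr (- d)"
    and G: "\<And>\<epsilon>. \<epsilon> > 0 \<Longrightarrow> continuous_on {- D \<epsilon> / 2..D \<epsilon> / 2} (G \<epsilon>)"
    and approx: "\<And>\<epsilon> x. \<epsilon> > 0 \<Longrightarrow> x \<in> {- D \<epsilon> / 2..D \<epsilon> / 2} \<Longrightarrow> \<bar>F x - G \<epsilon> x\<bar> < \<epsilon>"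
  defines "W \<equiv> \<lambda>\<epsilon> \<omega>. \<bar>gen_inverse (G \<epsilon>) (D \<epsilon>) (F (X \<omega>)) - X \<omega>\<bar> powr p"
  shows "\<And>\<epsilon>. \<epsilon> > 0 \<Longrightarrow> integrable M (W \<epsilon>)"
    and "((\<lambda>\<epsilon>. expectation (W \<epsilon>)) \<longlongrightarrow> 0) (at_right 0)"
proof -
  define Y where "Y \<epsilon> \<omega> = gen_inverse (G \<epsilon>) (D \<epsilon>) (F (X \<omega>))" for \<epsilon> \<omega>
  define U where "U \<omega> = F (X \<omega>)" for \<omega>
  interpret D: real_distribution "distr M borel X"
    by (intro real_distribution_distr X)
  have mono: "mono F" unfolding F by (auto intro: monoI D.cdf_nondecreasing)
  have U: "distributed M lborel U (\<lambda>x. indicator {0..1} x / measure lborel {0..1 :: real})"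
    unfolding U_def by (rule cdf_transform_uniform[OF X F cont])
  have [measurable]: "U \<in> borel_measurable M" using distributed_measurable[OF U] by simp
  have D0: "0 < D \<epsilon>" if "\<epsilon> > 0" for \<epsilon> using D that by simp
  have Y_meas: "Y \<epsilon> \<in> borel_measurable M" if "\<epsilon> > 0" for \<epsilon>
    using measurable_compose[OF \<open>U \<in> borel_measurable M\<close>
        borel_measurable_gen_inverse[OF G[OF that] less_imp_le[OF D0[OF that]]]]
    by (simp add: Y_def[abs_def] U_def)
  have W_Y: "W \<epsilon> = (\<lambda>\<omega>. \<bar>Y \<epsilon> \<omega> - X \<omega>\<bar> powr p)" for \<epsilon> by (simp add: W_def Y_def)
  have W_meas: "W \<epsilon> \<in> borel_measurable M" if "\<epsilon> > 0" for \<epsilon>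
    unfolding W_Y using Y_meas[OF that] by measurable
  have Y_mem: "Y \<epsilon> \<omega> \<in> {- D \<epsilon> / 2..D \<epsilon> / 2}" if "\<epsilon> > 0" for \<epsilon> \<omega>
    unfolding Y_def using G[OF that] D0[OF that] by (intro gen_inverse_mem) auto
  have Y_close: "\<bar>F (Y \<epsilon> \<omega>) - F (X \<omega>)\<bar> < \<epsilon>"
    if "\<epsilon> > 0" "X \<omega> \<in> {- D \<epsilon> / 2..D \<epsilon> / 2}" for \<epsilon> \<omega>
    unfolding Y_def using G[OF that(1)] D0[OF that(1)] that
    by (intro gen_inverse_cdf_close[where G = "G \<epsilon>"] mono approx) auto

  define q where "q = p / \<eta>"
  have q: "q < 1" using par by (simp add: q_def)
  \<comment> \<open>\<open>g\<close> and \<open>b\<close> are the two halves of the pointwise bound: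
    \<open>g\<close> is free of \<epsilon> and integrable since q < 1, while \<open>b\<close> is
    supported where U is within 2\<epsilon> of an end of [0,1].\<close>
  define g where "g \<omega> = 2 powr p * (2 * ((2 * R / U \<omega>) powr q + (2 * R / (1 - U \<omega>)) powr q))" for \<omega>
  define b :: "real \<Rightarrow> 'a \<Rightarrow> real" where
    "b \<epsilon> \<omega> = 2 powr p * (D \<epsilon> powr p * (indicator {..<2 * \<epsilon>} (U \<omega>) + indicator {..<2 * \<epsilon>} (1 - U \<omega>)))" for \<epsilon> \<omega>
  have g_int: "integrable M g"
  proof -
    have int: "integrable M (\<lambda>\<omega>. 2 powr p * (2 * ((2 * R) powr q * U \<omega> powr (- q) + (2 * R) powr q * (1 - U \<omega>) powr (- q))))"
      using integrable_powr_uniform[OF U, of "- q"] q by auto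
    have eq: "AE \<omega> in M. g \<omega> =
        2 powr p * (2 * ((2 * R) powr q * U \<omega> powr (- q) + (2 * R) powr q * (1 - U \<omega>) powr (- q)))"
      using AE_uniform_open_interval[OF U]
      by eventually_elim (use par in \<open>auto simp: g_def divide_inverse powr_mult inverse_powr powr_minus\<close>)
    show ?thesis
      by (rule integrable_cong_AE[THEN iffD2, OF _ _ eq int]) (simp_all add: g_def[abs_def])
  qed
  have b_int: "integrable M (b \<epsilon>)" for \<epsilon>
    unfolding b_def[abs_def]
    by (intro integrable_mult_right Bochner_Integration.integrable_add
        integrable_const_bound[where B = 1]) (auto simp: indicator_def)
  \<comment> \<open>The factor 4 collects two tails of probability at most 2\<epsilon> each.\<close>
  have b_le: "expectation (b \<epsilon>) \<le> 2 powr p * (D \<epsilon> powr p * (4 * \<epsilon>))" if "\<epsilon> > 0" for \<epsilon>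
  proof -
    have *: "expectation (\<lambda>\<omega>. indicator {..<2 * \<epsilon>} (V \<omega>)) \<le> 2 * \<epsilon>"
      "integrable M (\<lambda>\<omega>. indicator {..<2 * \<epsilon>} (V \<omega>) :: real)"
      if [measurable]: "V \<in> borel_measurable M" and V: "prob {\<omega> \<in> space M. V \<omega> < 2 * \<epsilon>} \<le> 2 * \<epsilon>" for V :: "'a \<Rightarrow> real"
    proof -
      have "expectation (\<lambda>\<omega>. indicator {..<2 * \<epsilon>} (V \<omega>)) = expectation (indicat_real {\<omega> \<in> space M. V \<omega> < 2 * \<epsilon>})"
        by (intro Bochner_Integration.integral_cong) (auto simp: indicator_def)
      then show "expectation (\<lambda>\<omega>. indicator {..<2 * \<epsilon>} (V \<omega>)) \<le> 2 * \<epsilon>" using V by simp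
      show "integrable M (\<lambda>\<omega>. indicator {..<2 * \<epsilon>} (V \<omega>) :: real)"
        by (intro integrable_const_bound[where B = 1]) (auto simp: indicator_def)
    qed
    have tl: "prob {\<omega> \<in> space M. U \<omega> < 2 * \<epsilon>} \<le> 2 * \<epsilon>" "prob {\<omega> \<in> space M. 1 - U \<omega> < 2 * \<epsilon>} \<le> 2 * \<epsilon>"
      using prob_uniform_tails_le[OF U, of "2 * \<epsilon>"] that by auto
    have "expectation (b \<epsilon>) = 2 powr p * (D \<epsilon> powr p * (expectation (\<lambda>\<omega>. indicator {..<2 * \<epsilon>} (U \<omega>))
        + expectation (\<lambda>\<omega>. indicator {..<2 * \<epsilon>} (1 - U \<omega>))))"
      unfolding b_def using *(2)[OF _ tl(1)] *(2)[OF _ tl(2)] by simp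
    also have "\<dots> \<le> 2 powr p * (D \<epsilon> powr p * (4 * \<epsilon>))"
      using *(1)[OF _ tl(1)] *(1)[OF _ tl(2)] by (intro mult_left_mono) auto
    finally show ?thesis .
  qed
  have b_lim: "((\<lambda>\<epsilon>. expectation (b \<epsilon>)) \<longlongrightarrow> 0) (at_right 0)"
  proof (rule tendsto_sandwich[OF _ _ tendsto_const])
    \<comment> \<open>The growth of the window competes with the rarity of the bad event: up to
      constants, the bound is \<epsilon> to the power 1 - dp, and d < 1/p makes this exponent
      positive.\<close>
    have "d * p < 1" using D(3) par by (simp add: field_simps)
    then have "((\<lambda>\<epsilon>. \<epsilon> powr (1 - d * p)) \<longlongrightarrow> 0) (at_right (0 :: real))"
      by real_asymp
    then show "((\<lambda>\<epsilon>. 2 powr p * (C powr p * 4) * \<epsilon> powr (1 - d * p)) \<longlongrightarrow> 0) (at_right 0)"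
      by (rule tendsto_mult_right_zero)
    show "\<forall>\<^sub>F \<epsilon> in at_right 0. expectation (b \<epsilon>) \<le> 2 powr p * (C powr p * 4) * \<epsilon> powr (1 - d * p)"
      unfolding eventually_at_right_field
    proof (intro exI[of _ 1] conjI allI impI)
      fix \<epsilon> :: real assume "0 < \<epsilon>"
      have "D \<epsilon> powr p = C powr p * \<epsilon> powr (- (d * p))"
        using D(1) D(4)[OF \<open>0 < \<epsilon>\<close>] by (simp add: powr_mult powr_powr)
      moreover have "\<epsilon> powr (1 - d * p) = \<epsilon> * \<epsilon> powr (- (d * p))"
        using \<open>0 < \<epsilon>\<close> powr_add[of \<epsilon> 1 "- (d * p)"] by simp
      ultimately have "D \<epsilon> powr p * (4 * \<epsilon>) = C powr p * 4 * \<epsilon> powr (1 - d * p)"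
        by simp
      then show "expectation (b \<epsilon>) \<le> 2 powr p * (C powr p * 4) * \<epsilon> powr (1 - d * p)"
        using b_le[OF \<open>0 < \<epsilon>\<close>] by (simp only: mult.assoc)
    qed simp
    show "\<forall>\<^sub>F \<epsilon> in at_right 0. 0 \<le> expectation (b \<epsilon>)"
      by (auto intro!: always_eventually integral_nonneg_AE simp: b_def)
  qed
  have W_le: "AE \<omega> in M. W \<epsilon> \<omega> \<le> g \<omega> + b \<epsilon> \<omega>" if "\<epsilon> > 0" for \<epsilon>
    using AE_uniform_open_interval[OF U]
  proof eventually_elim
    case (elim \<omega>)
    then show ?case
      unfolding W_Y g_def b_def q_def U_def using par
      by (intro cdf_close_powr_bound tails Y_mem[OF that] Y_close[OF that]) simp_all
  qed
  have W_lim: "AE \<omega> in M. ((\<lambda>\<epsilon>. W \<epsilon> \<omega>) \<longlongrightarrow> 0) (at_right 0)"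
    using AE_strictly_increasing_cdf[OF X F cont]
  proof eventually_elim
    case (elim \<omega>)
    \<comment> \<open>As d > 0, the window grows to the whole line and eventually contains the fixed
      value of X, so closeness becomes available.\<close>
    have "filterlim (\<lambda>\<epsilon>. C * \<epsilon> powr (- d)) at_top (at_right 0)"
      using D(1,2) by real_asymp
    then have "\<forall>\<^sub>F \<epsilon> in at_right 0. 2 * \<bar>X \<omega>\<bar> \<le> C * \<epsilon> powr (- d)"
      by (simp add: filterlim_at_top)
    then have "\<forall>\<^sub>F \<epsilon> in at_right 0. norm (F (Y \<epsilon> \<omega>) - F (X \<omega>)) \<le> \<epsilon>"
      using eventually_at_right_less[of "0 :: real"]
    proof eventually_elim
      case (elim \<epsilon>)
      then have "X \<omega> \<in> {- D \<epsilon> / 2..D \<epsilon> / 2}" using D(4)[of \<epsilon>] by auto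
      with elim have "\<bar>F (Y \<epsilon> \<omega>) - F (X \<omega>)\<bar> < \<epsilon>" by (intro Y_close)
      then show ?case by simp
    qed
    then have "((\<lambda>\<epsilon>. F (Y \<epsilon> \<omega>) - F (X \<omega>)) \<longlongrightarrow> 0) (at_right 0)"
      by (rule Lim_null_comparison) (auto intro: tendsto_ident_at)
    then have "((\<lambda>\<epsilon>. F (Y \<epsilon> \<omega>)) \<longlongrightarrow> F (X \<omega>)) (at_right 0)" by (rule LIM_zero_cancel)
    from tendsto_of_cdf_close[OF mono _ _ this] elim
    have "((\<lambda>\<epsilon>. Y \<epsilon> \<omega>) \<longlongrightarrow> X \<omega>) (at_right 0)" by blast
    then have "((\<lambda>\<epsilon>. \<bar>Y \<epsilon> \<omega> - X \<omega>\<bar>) \<longlongrightarrow> 0) (at_right 0)"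
      by (simp add: LIM_zero tendsto_rabs_zero)
    \<comment> \<open>The base tends to 0, where continuity of the power relies on p > 0.\<close>
    from tendsto_powr'[OF this tendsto_const[of p]] show ?case
      using par by (simp add: W_Y)
  qed
  show W_int: "integrable M (W \<epsilon>)" if "\<epsilon> > 0" for \<epsilon>
  proof (rule Bochner_Integration.integrable_bound)
    show "integrable M (\<lambda>\<omega>. g \<omega> + b \<epsilon> \<omega>)" using g_int b_int by simp
    show "AE \<omega> in M. norm (W \<epsilon> \<omega>) \<le> norm (g \<omega> + b \<epsilon> \<omega>)"
      using W_le[OF that] by eventually_elim (auto simp: W_def)
  qed (rule W_meas[OF that])
  show "((\<lambda>\<epsilon>. expectation (W \<epsilon>)) \<longlongrightarrow> 0) (at_right 0)"
  proof (rule integral_tendsto_0_dominated_up_to[where g = g and b = b, OF _ _ g_int _ _ _ b_lim _ W_lim])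
    show "0 \<le> W \<epsilon> \<omega>" "0 \<le> g \<omega>" "0 \<le> b \<epsilon> \<omega>" for \<epsilon> \<omega> by (simp_all add: W_def g_def b_def)
  qed (simp_all add: W_int b_int W_le)
qed

section \<open>Application to increments of a Levy process\<close>

text \<open>Integrability belongs to the conclusion because the integral of a non-integrable
  function is 0 by default, so the limit alone would say too little. The decay bound leaves out
  \<open>u = 0\<close>, where \<open>0 powr (- \<theta>) = 0\<close> would force the value 1 of the
  characteristic function to be at most 0.\<close>

theorem theorem3p14:
  fixes P :: "'a measure" and A :: "real \<Rightarrow> 'a measure" and L :: "real \<Rightarrow> 'a \<Rightarrow> real"
    and \<phi> :: "real \<Rightarrow> complex" and \<mu> :: "real measure" and F f :: "real \<Rightarrow> real"
    and X :: "'a \<Rightarrow> real" and D \<kappa> J :: "real \<Rightarrow> real" and M :: "real \<Rightarrow> nat"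
    and Xt :: "real \<Rightarrow> 'a \<Rightarrow> real"
    and \<Delta> R \<eta> B \<theta> C d p :: real
  assumes levy: "levy_process P A L" "levy_cf P L \<phi>"
    and step: "\<Delta> > 0"
    and law: "real_distribution \<mu>" "\<And>u. char \<mu> u = cf_pow \<phi> \<Delta> u"
    and F: "F = cdf \<mu>"
    and density: "\<And>x. (F has_real_derivative f x) (at x)" "continuous_on UNIV f"
    and variance: "integrable \<mu> (\<lambda>x. x\<^sup>2)"
    and constants: "R > 0" "\<eta> > 1" "B > 0" "\<theta> > 0"
    and tails: "\<And>x. x > 0 \<Longrightarrow> F (- x) \<le> R * \<bar>x\<bar> powr (- \<eta>)"
               "\<And>x. x > 0 \<Longrightarrow> 1 - F x \<le> R * \<bar>x\<bar> powr (- \<eta>)"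
    and decay: "\<And>u. u \<noteq> 0 \<Longrightarrow> norm (cf_pow \<phi> \<Delta> u) \<le> B * \<bar>u / (2 * pi)\<bar> powr (- \<theta>)"
    and X: "X \<in> borel_measurable P" "cdf (distr P borel X) = F"
    and D: "C > 0" "d > 0" "\<And>\<epsilon>. \<epsilon> > 0 \<Longrightarrow> D \<epsilon> = C * \<epsilon> powr (- d)"
    and params: "\<And>\<epsilon>. \<epsilon> > 0 \<Longrightarrow> 0 < \<kappa> \<epsilon> \<and> \<kappa> \<epsilon> < 2 / 3 \<and> J \<epsilon> \<ge> D \<epsilon> / \<kappa> \<epsilon> \<and> even (M \<epsilon>)"
    and approx: "\<And>\<epsilon> x. \<epsilon> > 0 \<Longrightarrow> x \<in> {- D \<epsilon> / 2..D \<epsilon> / 2} \<Longrightarrow>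
          \<bar>F x - approx_cdf \<phi> \<Delta> (\<kappa> \<epsilon>) (J \<epsilon>) (M \<epsilon>) x\<bar> < \<epsilon>"
    and Xt: "\<And>\<epsilon> \<omega>. \<epsilon> > 0 \<Longrightarrow>
          Xt \<epsilon> \<omega> = gen_inverse (approx_cdf \<phi> \<Delta> (\<kappa> \<epsilon>) (J \<epsilon>) (M \<epsilon>)) (D \<epsilon>) (F (X \<omega>))"
    and p: "1 \<le> p" "p < \<eta>" "d < 1 / p"
  shows "(\<forall>\<epsilon>>0. integrable P (\<lambda>\<omega>. \<bar>Xt \<epsilon> \<omega> - X \<omega>\<bar> powr p)) \<and>
         ((\<lambda>\<epsilon>. \<integral>\<omega>. \<bar>Xt \<epsilon> \<omega> - X \<omega>\<bar> powr p \<partial>P) \<longlongrightarrow> 0) (at_right 0)"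
proof -
  interpret levy_process P A L by (rule levy(1))
  have cont: "continuous_on UNIV F"
    using density(1) by (meson DERIV_isCont continuous_at_imp_continuous_on)
  \<comment> \<open>A finite trigonometric sum with coefficients constant in \<open>x\<close>;
    writing division as multiplication by a constant inverse avoids the side condition that
    \<open>j\<close> be nonzero.\<close>
  have G: "continuous_on I (approx_cdf \<phi> \<Delta> k j m)" for I k j m
    unfolding approx_cdf_def[abs_def] approx_cdf_complex_def divide_inverse
    by (intro continuous_intros)
  have "0 < p" using p(1) by simp
  let ?G = "\<lambda>\<epsilon>. approx_cdf \<phi> \<Delta> (\<kappa> \<epsilon>) (J \<epsilon>) (M \<epsilon>)"
  let ?W = "\<lambda>\<epsilon> \<omega>. \<bar>gen_inverse (?G \<epsilon>) (D \<epsilon>) (F (X \<omega>)) - X \<omega>\<bar> powr p"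
  note conv = gen_inverse_Lp_convergence[where D = D and G = ?G,
      OF X(1) X(2)[symmetric] cont constants(1) \<open>0 < p\<close> p(2) _ _ D(1,2) p(3)]
  have int: "integrable P (?W \<epsilon>)" if "\<epsilon> > 0" for \<epsilon>
    by (rule conv(1)) (rule tails D(3) G approx that; assumption?)+
  have lim: "((\<lambda>\<epsilon>. expectation (?W \<epsilon>)) \<longlongrightarrow> 0) (at_right 0)"
    by (rule conv(2)) (rule tails D(3) G approx; assumption?)+
  have eq: "?W \<epsilon> = (\<lambda>\<omega>. \<bar>Xt \<epsilon> \<omega> - X \<omega>\<bar> powr p)" if "\<epsilon> > 0" for \<epsilon>
    using that by (simp add: Xt)
  show ?thesis
  proof (intro conjI allI impI)
    show "integrable P (\<lambda>\<omega>. \<bar>Xt \<epsilon> \<omega> - X \<omega>\<bar> powr p)" if "\<epsilon> > 0" for \<epsilon>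
      using int[OF that] by (simp only: eq[OF that])
    show "((\<lambda>\<epsilon>. \<integral>\<omega>. \<bar>Xt \<epsilon> \<omega> - X \<omega>\<bar> powr p \<partial>P) \<longlongrightarrow> 0) (at_right 0)"
    \<comment> \<open>\<open>Xt \<epsilon>\<close> is specified for \<epsilon> > 0 only, so the two
      expectations agree eventually at 0 from the right, not everywhere.\<close>
    proof (rule Lim_transform_eventually[OF lim])
      show "\<forall>\<^sub>F \<epsilon> in at_right 0. expectation (?W \<epsilon>) = (\<integral>\<omega>. \<bar>Xt \<epsilon> \<omega> - X \<omega>\<bar> powr p \<partial>P)"
        using eventually_at_right_less[of "0 :: real"]
      proof eventually_elim
        case (elim \<epsilon>)
        then show ?case by (simp only: eq)
      qed
    qed
  qed
qed

end
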